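(* (Existence of PNE) A mixed-binary quadratic game $\mathcal{G}^{\mathrm{MBQP}}$ has at least one pure-strategy Nash equilibrium (PNE) if, for all players $i\in\mathcal{I}$: (i) property (KP) is satisfied for $\mathcal{P}_i^{\mathrm{MBQP}}(\mathbf{x}_{-i})$; (ii) $Q^{(i)}_{ii}\succeq0$; and (iii) there exists a PNE $(\mathbf{x}_i^*,X_i^* )_{i\in\mathcal{I}}$ of the corresponding game $\mathcal{G}^{\mathrm{CPP}}$ that satisfies $x^*_{ik}\in\{0,1\}$ for all $k\in\mathcal{B}_i$ and all $i\in\mathcal{I}$.
   Context: **Notation.** $\mathcal{C}_n^*=\{XX^\top: X\in\mathbb{R}^{n\times r}_+\text{ for some }r\}$ is the completely positive cone. $\mathbf{e}_l$ is the $l$-th unit vector. $\mathrm{opt}(\cdot)$ is the optimal value of a problem. **Game $\mathcal{G}^{\mathrm{MBQP}}$.** $\mathcal{I}$ is a finite set of players; player $i$ chooses $\mathbf{x}_i\in\mathbb{R}^{n_i}$; $\mathbf{x}=(\mathbf{x}_i)_{i\in\mathcal{I}}$, and $\mathbf{x}_{-i}$ denotes the strategies of all players other than $i$. Given $\mathbf{x}_{-i}$, player $i$ solves $$\mathcal{P}_i^{\mathrm{MBQP}}(\mathbf{x}_{-i}):\quad \min_{\mathbf{x}_i}\ f_i(\mathbf{x}_i,\mathbf{x}_{-i})=\mathbf{x}^\top Q^{(i)}\mathbf{x}+2\mathbf{c}^{(i)\top}\mathbf{x}$$ $$\text{s.t. } \mathbf{a}_j^{(i)\top}\mathbf{x}_i=b_j^{(i)},\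 j=1,\dots,m_i;\quad x_{ik}\in\{0,1\},\ k\in\mathcal{B}_i;\quad \mathbf{x}_i\in\mathbb{R}^{n_i}_+,$$ where $\mathcal{B}_i\subseteq\{1,\dots,n_i\}$ and $Q^{(i)}$ is a real symmetric matrix (of order $\sum_{i}n_i$), with blocks $Q^{(i)}_{ii}$, $Q^{(i)}_{-i,i}$, $Q^{(i)}_{-i,-i}$ according to the partition of $\mathbf{x}$ into $\mathbf{x}_i$ and $\mathbf{x}_{-i}$. The feasible set $\mathcal{X}_i$ (strategy set of player $i$) is assumed bounded. A PNE of $\mathcal{G}^{\mathrm{MBQP}}$ is $\mathbf{x}^*$ with $\mathbf{x}_i^*\in\mathcal{X}_i$ and $f_i(\mathbf{x}_i^*,\mathbf{x}_{-i}^* )=\mathrm{opt}(\mathcal{P}_i^{\mathrm{MBQP}}(\mathbf{x}_{-i}^* ))$ for all $i\in\mathcal{I}$. **Property (KP)** for $\mathcal{P}_i^{\mathrm{MBQP}}(\mathbf{x}_{-i})$: there is $\mathbf{y}\in\mathbb{R}^{m_i}$ with $\sum_jy_j\mathbf{a}_j^{(i)}\ge\mathbf{0}$ and $\sum_jy_jb_j^{(i)}=1$; when it holds, fix such $\mathbf{y}$ and set $\boldsymbol\alpha^{(i)}=\sum_jy_j\mathbf{a}_j^{(i)}$. **Corresponding game $\mathcal{G}^{\mathrm{CPP}}$.** Player $i$ chooses $(\mathbf{x}_i,X_i)$ with $\mathbf{x}_i\in\mathbb{R}^{n_i}$ and $X_i$ a symmetric $n_i\times n_i$ matrix; given $\mathbf{x}_{-i}$,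 player $i$ solves $$\mathcal{P}_i^{\mathrm{CPP}}(\mathbf{x}_{-i}):\quad\min_{\mathbf{x}_i,X_i}\ F_i(\mathbf{x}_i,X_i,\mathbf{x}_{-i})=\mathrm{Tr}(Q^{(i)}_{ii}X_i)+2\mathbf{x}_{-i}^\top Q^{(i)}_{-i,i}\mathbf{x}_i+\mathbf{x}_{-i}^\top Q^{(i)}_{-i,-i}\mathbf{x}_{-i}+2\mathbf{c}^{(i)\top}\mathbf{x}$$ $$\text{s.t. } \mathbf{a}_j^{(i)\top}\mathbf{x}_i=b_j^{(i)},\ \ \mathbf{a}_j^{(i)\top}X_i\mathbf{a}_j^{(i)}=(b_j^{(i)})^2\ (j=1,\dots,m_i);\quad x_{ik}=X_{i,kk}\ (k\in\mathcal{B}_i);$$ $$x_{il}=\mathrm{Tr}\left(\tfrac{\boldsymbol\alpha^{(i)}\mathbf{e}_l^\top+\mathbf{e}_l\boldsymbol\alpha^{(i)\top}}{2}X_i\right)\ (l=1,\dots,n_i);\quad X_i\in\mathcal{C}^*_{n_i}.$$ Its feasible set is the strategy set $\mathcal{X}_i'$. A PNE of $\mathcal{G}^{\mathrm{CPP}}$ is $(\mathbf{x}_i^*,X_i^* )_{i\in\mathcal{I}}$ with $(\mathbf{x}_i^*,X_i^* )\in\mathcal{X}_i'$ and $F_i(\mathbf{x}_i^*,X_i^*,\mathbf{x}_{-i}^* )=\mathrm{opt}(\mathcal{P}_i^{\mathrm{CPP}}(\mathbf{x}_{-i}^* ))$ for all $i\in\mathcal{I}$. *)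

theory Defs
  imports "Jordan_Normal_Form.Matrix" "HOL-Library.Extended_Real"
begin

section \<open>Matrix notions\<close>

definition outer_prod :: "real vec \<Rightarrow> real vec \<Rightarrow> real mat" where
  "outer_prod u v = mat (dim_vec u) (dim_vec v) (\<lambda>(k, l). u $ k * v $ l)"

definition trace :: "real mat \<Rightarrow> real" where
  "trace A = (\<Sum>k<dim_row A. A $$ (k, k))"

definition pos_semidef :: "nat \<Rightarrow> real mat \<Rightarrow> bool" where
  "pos_semidef n A \<longleftrightarrow> A \<in> carrier_mat n n \<and> transpose_mat A = A \<and>
     (\<forall>v \<in> carrier_vec n. 0 \<le> v \<bullet> (A *\<^sub>v v))"

definition completely_positive_cone :: "nat \<Rightarrow> real mat set" where
  "completely_positive_cone n =
     {M * transpose_mat M | M r. M \<in> carrier_mat n r \<and> 0\<^sub>m n r \<le> M}"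

definition bounded_vec_set :: "real vec set \<Rightarrow> bool" where
  "bounded_vec_set S \<longleftrightarrow> (\<exists>C. \<forall>v \<in> S. sqrt (v \<bullet> v) \<le> C)"

text \<open>
  Optimal values are taken in the extended reals, so that an infeasible problem has
  value \<open>\<infinity>\<close> and an unbounded one \<open>-\<infinity>\<close>.
\<close>

definition opt :: "'s set \<Rightarrow> ('s \<Rightarrow> real) \<Rightarrow> ereal" where
  "opt S g = (INF s\<in>S. ereal (g s))"


section \<open>Mixed-binary quadratic games\<close>

text \<open>
  Vectors indexed by all variables of all players are families of blocks, one vector per
  player; a matrix of order \<open>\<Sum>i. n\<^sub>i\<close> is a family of blocks indexed by pairs of players.
  So \<open>quad G i j k\<close> is the block of \<open>Q\<^sup>(\<^sup>i\<^sup>)\<close> with rows belonging to player \<open>j\<close> and columns to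
  player \<open>k\<close>, and \<open>lin G i j\<close> is the part of \<open>c\<^sup>(\<^sup>i\<^sup>)\<close> belonging to player \<open>j\<close>.
  Variables and constraints are numbered from 0.
\<close>

record 'p game =
  players :: "'p set"
  nvars :: "'p \<Rightarrow> nat"
  quad :: "'p \<Rightarrow> 'p \<Rightarrow> 'p \<Rightarrow> real mat"
  lin :: "'p \<Rightarrow> 'p \<Rightarrow> real vec"
  ncons :: "'p \<Rightarrow> nat"
  lhs :: "'p \<Rightarrow> nat \<Rightarrow> real vec"
  rhs :: "'p \<Rightarrow> nat \<Rightarrow> real"
  binvars :: "'p \<Rightarrow> nat set"

definition mbqp_strategies :: "'p game \<Rightarrow> 'p \<Rightarrow> real vec set" where
  "mbqp_strategies G i =
     {z \<in> carrier_vec (nvars G i).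
        (\<forall>j<ncons G i. lhs G i j \<bullet> z = rhs G i j) \<and>
        (\<forall>k\<in>binvars G i. z $ k \<in> {0, 1}) \<and>
        0\<^sub>v (nvars G i) \<le> z}"

definition mbqp_game :: "'p game \<Rightarrow> bool" where
  "mbqp_game G \<longleftrightarrow>
     finite (players G) \<and>
     (\<forall>i\<in>players G. \<forall>j\<in>players G. \<forall>k\<in>players G.
        quad G i j k \<in> carrier_mat (nvars G j) (nvars G k) \<and>
        transpose_mat (quad G i j k) = quad G i k j) \<and>
     (\<forall>i\<in>players G. \<forall>j\<in>players G. lin G i j \<in> carrier_vec (nvars G j)) \<and>
     (\<forall>i\<in>players G. \<forall>j<ncons G i. lhs G i j \<in> carrier_vec (nvars G i)) \<and>
     (\<forall>i\<in>players G. binvars G i \<subseteq> {..<nvars G i}) \<and>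
     (\<forall>i\<in>players G. bounded_vec_set (mbqp_strategies G i))"

definition lin_cost :: "'p game \<Rightarrow> 'p \<Rightarrow> ('p \<Rightarrow> real vec) \<Rightarrow> real" where
  "lin_cost G i x = (\<Sum>j\<in>players G. lin G i j \<bullet> x j)"

text \<open>
  The cost of player \<open>i\<close> playing \<open>z\<close> while the others play \<open>x\<^sub>-\<^sub>i\<close>; the profile \<open>x\<close> represents
  \<open>x\<^sub>-\<^sub>i\<close>, its value at \<open>i\<close> being overwritten or ignored.
\<close>

definition mbqp_cost :: "'p game \<Rightarrow> 'p \<Rightarrow> real vec \<Rightarrow> ('p \<Rightarrow> real vec) \<Rightarrow> real" where
  "mbqp_cost G i z x =
     (let w = x(i := z) in
        (\<Sum>j\<in>players G. \<Sum>k\<in>players G. w j \<bullet> (quad G i j k *\<^sub>v w k)) + 2 * lin_cost G i w)"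

definition mbqp_pne :: "'p game \<Rightarrow> ('p \<Rightarrow> real vec) \<Rightarrow> bool" where
  "mbqp_pne G x \<longleftrightarrow>
     (\<forall>i\<in>players G. x i \<in> mbqp_strategies G i \<and>
        ereal (mbqp_cost G i (x i) x) = opt (mbqp_strategies G i) (\<lambda>z. mbqp_cost G i z x))"


section \<open>Property (KP) and the completely positive game\<close>

definition agg_lhs :: "'p game \<Rightarrow> 'p \<Rightarrow> real vec \<Rightarrow> real vec" where
  "agg_lhs G i y = vec (nvars G i) (\<lambda>k. \<Sum>j<ncons G i. y $ j * lhs G i j $ k)"

definition KP_witness :: "'p game \<Rightarrow> 'p \<Rightarrow> real vec \<Rightarrow> bool" where
  "KP_witness G i y \<longleftrightarrow> y \<in> carrier_vec (ncons G i) \<and>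
     0\<^sub>v (nvars G i) \<le> agg_lhs G i y \<and> (\<Sum>j<ncons G i. y $ j * rhs G i j) = 1"

definition KP :: "'p game \<Rightarrow> 'p \<Rightarrow> bool" where
  "KP G i \<longleftrightarrow> (\<exists>y. KP_witness G i y)"

text \<open>
  The completely positive game depends on the multipliers \<open>y\<close> fixed for (KP), through
  \<open>\<alpha>\<^sup>(\<^sup>i\<^sup>) = agg_lhs G i (y i)\<close>.
\<close>

definition cpp_strategies :: "'p game \<Rightarrow> ('p \<Rightarrow> real vec) \<Rightarrow> 'p \<Rightarrow> (real vec \<times> real mat) set" where
  "cpp_strategies G y i =
     (let n = nvars G i; \<alpha> = agg_lhs G i (y i) in
      {(z, Z). z \<in> carrier_vec n \<and> Z \<in> carrier_mat n n \<and> transpose_mat Z = Z \<and>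
         (\<forall>j<ncons G i. lhs G i j \<bullet> z = rhs G i j \<and>
            lhs G i j \<bullet> (Z *\<^sub>v lhs G i j) = (rhs G i j)\<^sup>2) \<and>
         (\<forall>k\<in>binvars G i. z $ k = Z $$ (k, k)) \<and>
         (\<forall>l<n. z $ l =
            trace (((1/2) \<cdot>\<^sub>m (outer_prod \<alpha> (unit_vec n l) + outer_prod (unit_vec n l) \<alpha>)) * Z)) \<and>
         Z \<in> completely_positive_cone n})"

definition cpp_cost ::
    "'p game \<Rightarrow> 'p \<Rightarrow> real vec \<Rightarrow> real mat \<Rightarrow> ('p \<Rightarrow> real vec) \<Rightarrow> real" where
  "cpp_cost G i z Z x =
     (let others = players G - {i} in
        trace (quad G i i i * Z)
        + 2 * (\<Sum>j\<in>others. x j \<bullet> (quad G i j i *\<^sub>v z))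
        + (\<Sum>j\<in>others. \<Sum>k\<in>others. x j \<bullet> (quad G i j k *\<^sub>v x k))
        + 2 * lin_cost G i (x(i := z)))"

definition cpp_pne ::
    "'p game \<Rightarrow> ('p \<Rightarrow> real vec) \<Rightarrow> ('p \<Rightarrow> real vec) \<Rightarrow> ('p \<Rightarrow> real mat) \<Rightarrow> bool" where
  "cpp_pne G y x X \<longleftrightarrow>
     (\<forall>i\<in>players G. (x i, X i) \<in> cpp_strategies G y i \<and>
        ereal (cpp_cost G i (x i) (X i) x) =
          opt (cpp_strategies G y i) (\<lambda>(z, Z). cpp_cost G i z Z x))"

end

theory Submission
  imports Defs
begin

text \<open>
  The first components \<open>x\<close> of the given equilibrium of the completely positive game are
  themselves an equilibrium of the mixed-binary game. For a fixed player with own block \<open>Q\<close>,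
  two comparisons of that player's costs are needed; by lemma \<open>mbqp_cost_conv_cpp_cost\<close>, replacing
  \<open>z\<^sup>T Q z\<close> by \<open>Tr (Q Z)\<close> is the only way in which the costs differ.

  Lifting is exact: a mixed-binary strategy \<open>z\<close> gives the strategy \<open>(z, z z\<^sup>T)\<close> of the same
  cost. So the equilibrium cost in the completely positive game is at most the cost of any
  mixed-binary deviation. The (KP) multipliers enter here because \<open>\<alpha> \<bullet> z = 1\<close>, which makes the
  constraint \<open>z = Z \<alpha>\<close> hold for \<open>Z = z z\<^sup>T\<close>.

  Projecting does not raise the cost: let \<open>(x, X)\<close> be the equilibrium strategy. Then
  \<open>x = X \<alpha>\<close> is nonnegative because \<open>X\<close> and \<open>\<alpha>\<close> are, so together with the assumed integrality
  \<open>x\<close> is a mixed-binary strategy. Moreover \<open>\<alpha>\<^sup>T X \<alpha> = \<alpha> \<bullet> x = 1\<close>, whence \<open>X - x x\<^sup>T\<close> is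
  positive semidefinite and convexity of \<open>Q\<close> gives \<open>x\<^sup>T Q x \<le> Tr (Q X)\<close>
  (lemma \<open>quadratic_form_le_trace\<close>).

  Chaining the two comparisons, \<open>x\<close> costs the player no more than any mixed-binary deviation.
\<close>

section \<open>Traces and quadratic forms\<close>

lemma quadratic_form_sum:
  fixes A :: "real mat"
  assumes "A \<in> carrier_mat n m" "v \<in> carrier_vec n" "w \<in> carrier_vec m"
  shows "v \<bullet> (A *\<^sub>v w) = (\<Sum>k<n. \<Sum>l<m. v $ k * A $$ (k, l) * w $ l)"
  using assms
  by (auto simp: scalar_prod_def atLeast0LessThan sum_distrib_left mult.assoc intro!: sum.cong)

lemma quadratic_form_transpose:
  fixes A :: "real mat"
  assumes "A \<in> carrier_mat n m" "v \<in> carrier_vec n" "w \<in> carrier_vec m"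
  shows "v \<bullet> (A *\<^sub>v w) = w \<bullet> (transpose_mat A *\<^sub>v v)"
proof -
  have "w \<bullet> (transpose_mat A *\<^sub>v v) = (\<Sum>l<m. \<Sum>k<n. w $ l * A $$ (k, l) * v $ k)"
    using assms by (subst quadratic_form_sum[of _ m n]) auto
  also have "\<dots> = (\<Sum>k<n. \<Sum>l<m. v $ k * A $$ (k, l) * w $ l)"
    by (subst sum.swap) (simp add: mult_ac)
  finally show ?thesis
    using assms by (simp add: quadratic_form_sum)
qed

lemma trace_mult_sum:
  assumes "A \<in> carrier_mat n m" "B \<in> carrier_mat m n"
  shows "trace (A * B) = (\<Sum>k<n. \<Sum>l<m. A $$ (k, l) * B $$ (l, k))"
  using assms by (auto simp: trace_def scalar_prod_def atLeast0LessThan intro!: sum.cong)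

lemma trace_mult_Gram:
  assumes A: "A \<in> carrier_mat n n" and M: "M \<in> carrier_mat n r"
  shows "trace (A * (M * transpose_mat M)) = (\<Sum>t<r. col M t \<bullet> (A *\<^sub>v col M t))"
proof -
  have "trace (A * (M * transpose_mat M)) =
      (\<Sum>k<n. \<Sum>l<n. \<Sum>t<r. M $$ (k, t) * A $$ (k, l) * M $$ (l, t))"
    using A M
    by (subst trace_mult_sum[of _ n n])
      (auto simp: scalar_prod_def atLeast0LessThan sum_distrib_left mult_ac intro!: sum.cong)
  also have "\<dots> = (\<Sum>k<n. \<Sum>t<r. \<Sum>l<n. M $$ (k, t) * A $$ (k, l) * M $$ (l, t))"
    by (intro sum.cong refl sum.swap)
  also have "\<dots> = (\<Sum>t<r. \<Sum>k<n. \<Sum>l<n. M $$ (k, t) * A $$ (k, l) * M $$ (l, t))"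
    by (rule sum.swap)
  also have "\<dots> = (\<Sum>t<r. col M t \<bullet> (A *\<^sub>v col M t))"
    using A M by (intro sum.cong refl, subst quadratic_form_sum[of _ n n]) auto
  finally show ?thesis .
qed

text \<open>
  The symmetrisation leaves the functional unchanged on symmetric matrices, so the constraints
  linking \<open>x\<close> and \<open>X\<close> in the completely positive problem together say \<open>x = X \<alpha>\<close>.
\<close>
lemma trace_symmetrised_outer_prod:
  assumes Z: "Z \<in> carrier_mat n n" and sym: "transpose_mat Z = Z"
    and a: "a \<in> carrier_vec n" and l: "l < n"
  shows "trace (((1/2) \<cdot>\<^sub>m (outer_prod a (unit_vec n l) + outer_prod (unit_vec n l) a)) * Z)
           = (Z *\<^sub>v a) $ l"
proof -
  let ?e = "unit_vec n l :: real vec"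
  have Zsym: "Z $$ (k, l') = Z $$ (l', k)" if "k < n" "l' < n" for k l'
    using Z that index_transpose_mat(1)[of l' Z k] by (simp add: sym)
  have "trace (((1/2) \<cdot>\<^sub>m (outer_prod a ?e + outer_prod ?e a)) * Z)
      = (\<Sum>k<n. \<Sum>j<n. (a $ k * ?e $ j + ?e $ k * a $ j) / 2 * Z $$ (j, k))"
    using Z a
    by (subst trace_mult_sum[of _ n n]) (auto simp: outer_prod_def)
  also have "\<dots> = (\<Sum>k<n. \<Sum>j<n. a $ k * Z $$ (j, k) / 2 * of_bool (j = l))
                 + (\<Sum>k<n. \<Sum>j<n. a $ j * Z $$ (j, k) / 2 * of_bool (k = l))"
    using l by (simp flip: sum.distrib)
      (intro sum.cong refl, auto simp: field_simps unit_vec_def)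
  also have "\<dots> = (\<Sum>k<n. a $ k * Z $$ (l, k) / 2) + (\<Sum>j<n. a $ j * Z $$ (j, l) / 2)"
    using l by (subst (2) sum.swap) (simp add: sum.delta of_bool_def if_distrib cong: if_cong)
  also have "\<dots> = (\<Sum>k<n. Z $$ (l, k) * a $ k)"
    using l by (simp add: Zsym[of _ l] mult.commute flip: sum.distrib)
  also have "\<dots> = (Z *\<^sub>v a) $ l"
    using Z a l by (simp add: scalar_prod_def atLeast0LessThan)
  finally show ?thesis .
qed

section \<open>The completely positive cone\<close>

lemma completely_positive_nonneg:
  assumes "Z \<in> completely_positive_cone n" "k < n" "l < n"
  shows "0 \<le> Z $$ (k, l)"
proof -
  obtain M r where M: "M \<in> carrier_mat n r" "0\<^sub>m n r \<le> M" and Z: "Z = M * transpose_mat M"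
    using assms(1) unfolding completely_positive_cone_def by auto
  have "0 \<le> M $$ (i, t)" if "i < n" "t < r" for i t
    using M that unfolding less_eq_mat_def by auto
  then show ?thesis
    using M(1) assms(2,3) by (auto simp: Z scalar_prod_def intro!: sum_nonneg)
qed

lemma outer_prod_self_eq_Gram:
  assumes "z \<in> carrier_vec n"
  shows "outer_prod z z = mat_of_cols n [z] * transpose_mat (mat_of_cols n [z])"
  using assms
  by (intro eq_matI) (auto simp: outer_prod_def scalar_prod_def mat_of_cols_def)

lemma outer_prod_self_completely_positive:
  assumes "z \<in> carrier_vec n" "0\<^sub>v n \<le> z"
  shows "outer_prod z z \<in> completely_positive_cone n"
proof -
  have "mat_of_cols n [z] \<in> carrier_mat n 1" "0\<^sub>m n 1 \<le> mat_of_cols n [z]"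
    using assms by (auto simp: less_eq_mat_def less_eq_vec_def mat_of_cols_def)
  then show ?thesis
    unfolding completely_positive_cone_def using outer_prod_self_eq_Gram[OF assms(1)] by blast
qed

lemma trace_mult_outer_prod_self:
  assumes "A \<in> carrier_mat n n" "z \<in> carrier_vec n"
  shows "trace (A * outer_prod z z) = z \<bullet> (A *\<^sub>v z)"
proof -
  have "trace (A * outer_prod z z) =
      (\<Sum>t<1. col (mat_of_cols n [z]) t \<bullet> (A *\<^sub>v col (mat_of_cols n [z]) t))"
    unfolding outer_prod_self_eq_Gram[OF assms(2)]
    using assms by (intro trace_mult_Gram) (auto simp: mat_of_cols_def)
  then show ?thesis
    using assms by (simp add: col_mat_of_cols)
qed

lemma outer_prod_self_mult_vec:
  assumes "z \<in> carrier_vec n" "a \<in> carrier_vec n"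
  shows "outer_prod z z *\<^sub>v a = (a \<bullet> z) \<cdot>\<^sub>v z"
  using assms
  by (intro eq_vecI)
    (auto simp: outer_prod_def scalar_prod_def sum_distrib_left sum_distrib_right mult_ac)

text \<open>
  The normalisation \<open>a\<^sup>T Z a = 1\<close> makes \<open>Z - x x\<^sup>T\<close> positive semidefinite for \<open>x = Z a\<close>. Instead of
  factorising \<open>Q\<close>, write \<open>Z\<close> as the sum of \<open>m\<^sub>t m\<^sub>t\<^sup>T\<close> over the columns of a factor and put
  \<open>\<mu>\<^sub>t = a \<bullet> m\<^sub>t\<close>. Then \<open>\<Sum>\<^sub>t \<mu>\<^sub>t\<^sup>2 = 1\<close> and \<open>\<Sum>\<^sub>t \<mu>\<^sub>t m\<^sub>t = x\<close>, so the difference of the two sides is the sum of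
  the nonnegative numbers \<open>(m\<^sub>t - \<mu>\<^sub>t x)\<^sup>T Q (m\<^sub>t - \<mu>\<^sub>t x)\<close>.
\<close>
lemma quadratic_form_le_trace:
  assumes Q: "pos_semidef n Q" and Z: "Z \<in> completely_positive_cone n"
    and a: "a \<in> carrier_vec n" and x: "x = Z *\<^sub>v a" and norm: "a \<bullet> x = 1"
  shows "x \<bullet> (Q *\<^sub>v x) \<le> trace (Q * Z)"
proof -
  obtain M r where M: "M \<in> carrier_mat n r" and Z_eq: "Z = M * transpose_mat M"
    using Z unfolding completely_positive_cone_def by auto
  have Qc: "Q \<in> carrier_mat n n" and Qsym: "transpose_mat Q = Q"
    and Qpos: "\<And>v. v \<in> carrier_vec n \<Longrightarrow> 0 \<le> v \<bullet> (Q *\<^sub>v v)"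
    using Q unfolding pos_semidef_def by auto
  define \<mu> where "\<mu> = transpose_mat M *\<^sub>v a"
  have \<mu>c: "\<mu> \<in> carrier_vec r"
    using M a by (auto simp: \<mu>_def)
  have x_eq: "x = M *\<^sub>v \<mu>"
    using M a by (simp add: x Z_eq \<mu>_def assoc_mult_mat_vec[of M n r])
  have xc: "x \<in> carrier_vec n"
    using M \<mu>c by (simp add: x_eq)
  \<comment> \<open>\<open>x = \<Sum>\<^sub>t \<mu>\<^sub>t m\<^sub>t\<close>, tested against \<open>v\<close>; it is used with \<open>v = a\<close> and \<open>v = Q x\<close>.\<close>
  have pairing: "v \<bullet> x = (\<Sum>t<r. \<mu> $ t * (v \<bullet> col M t))" if v: "v \<in> carrier_vec n" for v
  proof -
    have "v \<bullet> x = (\<Sum>k<n. \<Sum>t<r. v $ k * M $$ (k, t) * \<mu> $ t)"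
      unfolding x_eq using M v \<mu>c by (rule quadratic_form_sum)
    also have "\<dots> = (\<Sum>t<r. \<Sum>k<n. v $ k * M $$ (k, t) * \<mu> $ t)"
      by (rule sum.swap)
    also have "\<dots> = (\<Sum>t<r. \<mu> $ t * (v \<bullet> col M t))"
      using M by (auto simp: scalar_prod_def atLeast0LessThan sum_distrib_left mult_ac
          intro!: sum.cong)
    finally show ?thesis .
  qed
  have \<mu>_norm: "(\<Sum>t<r. (\<mu> $ t)\<^sup>2) = 1"
  proof -
    have "\<mu> $ t = a \<bullet> col M t" if "t < r" for t
      using M a that by (simp add: \<mu>_def comm_scalar_prod[of _ n])
    then show ?thesis
      using pairing[OF a] norm by (simp add: power2_eq_square)
  qed
  let ?m = "\<lambda>t. col M t"
  have mc: "?m t \<in> carrier_vec n" for t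
    using M by auto
  have Qxc: "Q *\<^sub>v x \<in> carrier_vec n"
    using Qc xc by simp
  have expand: "(?m t - \<mu> $ t \<cdot>\<^sub>v x) \<bullet> (Q *\<^sub>v (?m t - \<mu> $ t \<cdot>\<^sub>v x)) =
      ?m t \<bullet> (Q *\<^sub>v ?m t) - 2 * (\<mu> $ t * ((Q *\<^sub>v x) \<bullet> ?m t)) + (\<mu> $ t)\<^sup>2 * (x \<bullet> (Q *\<^sub>v x))" for t
  proof -
    let ?Qm = "Q *\<^sub>v ?m t"
    have Qmc: "?Qm \<in> carrier_vec n"
      using Qc mc[of t] by simp
    have "x \<bullet> ?Qm = ?m t \<bullet> (Q *\<^sub>v x)"
      using quadratic_form_transpose[OF Qc xc mc[of t]] by (simp add: Qsym)
    moreover have "?m t \<bullet> (Q *\<^sub>v x) = (Q *\<^sub>v x) \<bullet> ?m t"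
      using mc[of t] Qxc by (rule comm_scalar_prod)
    moreover have "Q *\<^sub>v (?m t - \<mu> $ t \<cdot>\<^sub>v x) = ?Qm - \<mu> $ t \<cdot>\<^sub>v (Q *\<^sub>v x)"
      using Qc mc[of t] xc by (simp add: mult_minus_distrib_mat_vec mult_mat_vec[of Q n n])
    ultimately show ?thesis
      using mc[of t] xc Qmc Qxc
      by (simp add: minus_scalar_prod_distrib[of _ n] scalar_prod_minus_distrib[of _ n]
          power2_eq_square algebra_simps)
  qed
  have "0 \<le> (\<Sum>t<r. (?m t - \<mu> $ t \<cdot>\<^sub>v x) \<bullet> (Q *\<^sub>v (?m t - \<mu> $ t \<cdot>\<^sub>v x)))"
    using mc xc by (intro sum_nonneg Qpos) auto
  also have "\<dots> = trace (Q * Z) - 2 * ((Q *\<^sub>v x) \<bullet> x) + x \<bullet> (Q *\<^sub>v x)"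
    unfolding expand
    by (simp add: sum.distrib sum_subtractf Z_eq trace_mult_Gram[OF Qc M] pairing[OF Qxc] \<mu>_norm
        flip: sum_distrib_left sum_distrib_right)
  also have "(Q *\<^sub>v x) \<bullet> x = x \<bullet> (Q *\<^sub>v x)"
    using Qxc xc by (rule comm_scalar_prod)
  finally show ?thesis by simp
qed

section \<open>Relating the two games\<close>

lemma agg_lhs_carrier [simp]: "agg_lhs G i w \<in> carrier_vec (nvars G i)"
  by (simp add: agg_lhs_def)

lemma agg_lhs_scalar_prod:
  assumes KP: "KP_witness G i w"
    and z: "z \<in> carrier_vec (nvars G i)" and eqs: "\<forall>j<ncons G i. lhs G i j \<bullet> z = rhs G i j"
  shows "agg_lhs G i w \<bullet> z = 1"
proof -
  have "agg_lhs G i w \<bullet> z = (\<Sum>k<nvars G i. \<Sum>j<ncons G i. w $ j * (lhs G i j $ k * z $ k))"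
    using z by (simp add: agg_lhs_def scalar_prod_def atLeast0LessThan sum_distrib_right mult.assoc)
  also have "\<dots> = (\<Sum>j<ncons G i. w $ j * (lhs G i j \<bullet> z))"
    using z by (subst sum.swap) (simp add: scalar_prod_def atLeast0LessThan sum_distrib_left)
  also have "\<dots> = 1"
    using eqs KP by (simp add: KP_witness_def)
  finally show ?thesis .
qed

lemma cpp_strategies_link:
  assumes "(z, Z) \<in> cpp_strategies G y i"
  shows "z = Z *\<^sub>v agg_lhs G i (y i)"
proof (rule eq_vecI)
  show "dim_vec z = dim_vec (Z *\<^sub>v agg_lhs G i (y i))"
    using assms by (auto simp: cpp_strategies_def Let_def)
  show "z $ l = (Z *\<^sub>v agg_lhs G i (y i)) $ l" if "l < dim_vec (Z *\<^sub>v agg_lhs G i (y i))" for l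
    using assms that trace_symmetrised_outer_prod[of Z "nvars G i" "agg_lhs G i (y i)" l]
    by (auto simp: cpp_strategies_def Let_def)
qed

lemma cpp_strategy_projection:
  assumes KP: "KP_witness G i (y i)" and zZ: "(z, Z) \<in> cpp_strategies G y i"
    and bin: "\<forall>k\<in>binvars G i. z $ k \<in> {0, 1}"
  shows "z \<in> mbqp_strategies G i"
proof -
  let ?n = "nvars G i" and ?a = "agg_lhs G i (y i)"
  have z: "z \<in> carrier_vec ?n" and Z: "Z \<in> carrier_mat ?n ?n" "Z \<in> completely_positive_cone ?n"
    using zZ by (auto simp: cpp_strategies_def Let_def)
  have a: "0 \<le> ?a $ k" if "k < ?n" for k
    using KP that by (auto simp: KP_witness_def less_eq_vec_def agg_lhs_def)
  have "0 \<le> z $ l" if "l < ?n" for l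
  proof -
    have "z $ l = (\<Sum>k<?n. Z $$ (l, k) * ?a $ k)"
      using Z that by (subst cpp_strategies_link[OF zZ])
        (simp add: scalar_prod_def atLeast0LessThan agg_lhs_def)
    also have "\<dots> \<ge> 0"
      using a that by (auto intro!: sum_nonneg mult_nonneg_nonneg completely_positive_nonneg[OF Z(2)])
    finally show ?thesis .
  qed
  then show ?thesis
    using z zZ bin by (auto simp: mbqp_strategies_def cpp_strategies_def Let_def less_eq_vec_def)
qed

lemma mbqp_strategy_lift:
  assumes game: "mbqp_game G" and i: "i \<in> players G" and KP: "KP_witness G i (y i)"
    and z: "z \<in> mbqp_strategies G i"
  shows "(z, outer_prod z z) \<in> cpp_strategies G y i"
proof -
  let ?n = "nvars G i" and ?a = "agg_lhs G i (y i)" and ?Z = "outer_prod z z"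
  have zc: "z \<in> carrier_vec ?n" and eqs: "\<forall>j<ncons G i. lhs G i j \<bullet> z = rhs G i j"
    and bin: "\<forall>k\<in>binvars G i. z $ k \<in> {0, 1}" and nonneg: "0\<^sub>v ?n \<le> z"
    using z by (auto simp: mbqp_strategies_def)
  have lhs: "lhs G i j \<in> carrier_vec ?n" if "j < ncons G i" for j
    using game i that by (auto simp: mbqp_game_def)
  have bins: "binvars G i \<subseteq> {..<?n}"
    using game i by (auto simp: mbqp_game_def)
  have Zc: "?Z \<in> carrier_mat ?n ?n" and Zsym: "transpose_mat ?Z = ?Z"
    using zc by (auto simp: outer_prod_def intro!: eq_matI)
  have "lhs G i j \<bullet> (?Z *\<^sub>v lhs G i j) = (rhs G i j)\<^sup>2" if "j < ncons G i" for j
    using eqs lhs[OF that] zc that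
    by (simp add: outer_prod_self_mult_vec[of _ ?n] power2_eq_square)
  moreover have "z $ k = ?Z $$ (k, k)" if "k \<in> binvars G i" for k
    using bin bins zc that by (auto simp: outer_prod_def)
  moreover have "z $ l = trace (((1/2) \<cdot>\<^sub>m (outer_prod ?a (unit_vec ?n l)
      + outer_prod (unit_vec ?n l) ?a)) * ?Z)" if "l < ?n" for l
    using trace_symmetrised_outer_prod[OF Zc Zsym _ that, of ?a]
      agg_lhs_scalar_prod[OF KP zc eqs] zc
    by (simp add: outer_prod_self_mult_vec[of _ ?n])
  moreover have "?Z \<in> completely_positive_cone ?n"
    using zc nonneg by (rule outer_prod_self_completely_positive)
  ultimately show ?thesis
    using zc Zc Zsym eqs unfolding cpp_strategies_def Let_def by blast
qed

text \<open>
  The two mixed sums over the other players agree by symmetry of the quadratic form, which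
  accounts for the factor 2 in the completely positive cost.
\<close>
lemma mbqp_cost_conv_cpp_cost:
  assumes game: "mbqp_game G" and i: "i \<in> players G"
    and x: "\<And>j. j \<in> players G \<Longrightarrow> x j \<in> carrier_vec (nvars G j)"
    and z: "z \<in> carrier_vec (nvars G i)"
  shows "mbqp_cost G i z x =
    cpp_cost G i z Z x + z \<bullet> (quad G i i i *\<^sub>v z) - trace (quad G i i i * Z)"
proof -
  let ?w = "x(i := z)" and ?O = "players G - {i}"
  let ?f = "\<lambda>j k. ?w j \<bullet> (quad G i j k *\<^sub>v ?w k)"
  have fin: "finite (players G)"
    using game by (simp add: mbqp_game_def)
  have split: "(\<Sum>j\<in>players G. g j) = g i + (\<Sum>j\<in>?O. g j)" for g :: "'a \<Rightarrow> real"
    using fin i by (rule sum.remove)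
  have swap: "?f i j = ?f j i" if "j \<in> ?O" for j
  proof -
    have "quad G i i j \<in> carrier_mat (nvars G i) (nvars G j)"
      "transpose_mat (quad G i i j) = quad G i j i"
      using game i that by (auto simp: mbqp_game_def)
    then show ?thesis
      using quadratic_form_transpose[of "quad G i i j" "nvars G i" "nvars G j" z "x j"] x z that
      by auto
  qed
  have "(\<Sum>j\<in>players G. \<Sum>k\<in>players G. ?f j k)
      = ?f i i + (\<Sum>j\<in>?O. ?f i j) + (\<Sum>j\<in>?O. ?f j i) + (\<Sum>j\<in>?O. \<Sum>k\<in>?O. ?f j k)"
    by (simp only: split sum.distrib add.assoc)
  also have "(\<Sum>j\<in>?O. ?f i j) = (\<Sum>j\<in>?O. ?f j i)"
    by (intro sum.cong refl swap)
  finally have "(\<Sum>j\<in>players G. \<Sum>k\<in>players G. ?f j k)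
      = ?f i i + 2 * (\<Sum>j\<in>?O. ?f j i) + (\<Sum>j\<in>?O. \<Sum>k\<in>?O. ?f j k)"
    by simp
  moreover have "(\<Sum>j\<in>?O. ?f j i) = (\<Sum>j\<in>?O. x j \<bullet> (quad G i j i *\<^sub>v z))"
    by (intro sum.cong) auto
  moreover have "(\<Sum>j\<in>?O. \<Sum>k\<in>?O. ?f j k) = (\<Sum>j\<in>?O. \<Sum>k\<in>?O. x j \<bullet> (quad G i j k *\<^sub>v x k))"
    by (intro sum.cong) auto
  ultimately show ?thesis
    by (simp add: mbqp_cost_def cpp_cost_def Let_def)
qed

theorem proposition3:
  fixes G :: "'p game" and y :: "'p \<Rightarrow> real vec"
  assumes game: "mbqp_game G"
    and fixed_multipliers: "\<And>i. i \<in> players G \<Longrightarrow> KP G i \<Longrightarrow> KP_witness G i (y i)"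
    and kp: "\<And>i. i \<in> players G \<Longrightarrow> KP G i"
    and psd: "\<And>i. i \<in> players G \<Longrightarrow> pos_semidef (nvars G i) (quad G i i i)"
    and cpp: "\<exists>x X. cpp_pne G y x X \<and>
                (\<forall>i\<in>players G. \<forall>k\<in>binvars G i. x i $ k \<in> {0, 1})"
  shows "\<exists>x. mbqp_pne G x"
proof -
  obtain x X where pne: "cpp_pne G y x X"
    and bin: "\<forall>i\<in>players G. \<forall>k\<in>binvars G i. x i $ k \<in> {0, 1}"
    using cpp by blast
  have strat: "(x i, X i) \<in> cpp_strategies G y i" if "i \<in> players G" for i
    using pne that by (simp add: cpp_pne_def)
  have xc: "x i \<in> carrier_vec (nvars G i)" if "i \<in> players G" for i
    using strat[OF that] by (auto simp: cpp_strategies_def Let_def)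
  have "x i \<in> mbqp_strategies G i \<and>
      ereal (mbqp_cost G i (x i) x) = opt (mbqp_strategies G i) (\<lambda>z. mbqp_cost G i z x)"
    if i: "i \<in> players G" for i
  proof
    let ?Q = "quad G i i i" and ?a = "agg_lhs G i (y i)"
    have KPw: "KP_witness G i (y i)"
      using fixed_multipliers kp i by blast
    show mem: "x i \<in> mbqp_strategies G i"
      using KPw strat[OF i] bin i by (intro cpp_strategy_projection) auto
    have norm: "?a \<bullet> x i = 1"
      using mem by (intro agg_lhs_scalar_prod[OF KPw xc[OF i]])
        (auto simp: mbqp_strategies_def)
    have "x i \<bullet> (?Q *\<^sub>v x i) \<le> trace (?Q * X i)"
    proof (rule quadratic_form_le_trace[OF psd[OF i] _ agg_lhs_carrier _ norm])
      show "X i \<in> completely_positive_cone (nvars G i)"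
        using strat[OF i] by (simp add: cpp_strategies_def Let_def)
      show "x i = X i *\<^sub>v ?a"
        using strat[OF i] by (rule cpp_strategies_link)
    qed
    then have project: "mbqp_cost G i (x i) x \<le> cpp_cost G i (x i) (X i) x"
      using mbqp_cost_conv_cpp_cost[OF game i xc xc[OF i], where Z = "X i"] by simp
    have lift: "cpp_cost G i (x i) (X i) x \<le> mbqp_cost G i z x"
      if z: "z \<in> mbqp_strategies G i" for z
    proof -
      have zc: "z \<in> carrier_vec (nvars G i)"
        using z by (simp add: mbqp_strategies_def)
      have Qc: "?Q \<in> carrier_mat (nvars G i) (nvars G i)"
        using psd[OF i] by (simp add: pos_semidef_def)
      have "ereal (cpp_cost G i (x i) (X i) x) =
          (INF (z, Z)\<in>cpp_strategies G y i. ereal (cpp_cost G i z Z x))"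
        using pne i by (simp add: cpp_pne_def opt_def case_prod_unfold)
      also have "\<dots> \<le> ereal (cpp_cost G i z (outer_prod z z) x)"
        using mbqp_strategy_lift[where y = y, OF game i KPw z] by (intro INF_lower2) auto
      also have "cpp_cost G i z (outer_prod z z) x = mbqp_cost G i z x"
        using mbqp_cost_conv_cpp_cost[OF game i xc zc, where Z = "outer_prod z z"]
          trace_mult_outer_prod_self[OF Qc zc] by simp
      finally show ?thesis by simp
    qed
    show "ereal (mbqp_cost G i (x i) x) = opt (mbqp_strategies G i) (\<lambda>z. mbqp_cost G i z x)"
      unfolding opt_def
    proof (rule antisym)
      show "ereal (mbqp_cost G i (x i) x) \<le> (INF z\<in>mbqp_strategies G i. ereal (mbqp_cost G i z x))"
        by (intro INF_greatest) (simp only: ereal_less_eq order_trans[OF project lift])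
      show "(INF z\<in>mbqp_strategies G i. ereal (mbqp_cost G i z x)) \<le> ereal (mbqp_cost G i (x i) x)"
        using mem by (rule INF_lower)
    qed
  qed
  then show ?thesis
    unfolding mbqp_pne_def by blast
qed

end
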